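(* For all integers $2\le \ell<k$: (i) $\tau(\vec P_k^{(2)})=\left\lfloor \frac{3k-1}{2}\right\rfloor$; (ii) $\left\lfloor \frac{7k-1}{6}\right\rfloor\le \tau(\vec P_k^{(3)})\le 3k$; (iii) $\tau(\vec P_k^{(\ell)})=k$ if $\ell\ge 4$.
   Context: For $2\le \ell<k$, $\vec P_k^{(\ell)}$ is the oriented graph on vertices $v_1,\dots,v_k$ with arcs $v_iv_{i+1}$ for $1\le i\le k-1$ and $v_iv_{i+\ell}$ for $1\le i\le k-\ell$. A tournament is an orientation of a complete graph. A homomorphism $H\to T$ is a map $f:V(H)\to V(T)$ such that $f(u)f(v)$ is an arc of $T$ for every arc $uv$ of $H$. The compressibility $\tau(H)$ of an oriented graph $H$ is the smallest $k\in\mathbb N$ such that for every tournament $T$ on $k$ vertices there is a homomorphism $H\to T$ ($\infty$ if none exists). *)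

theory Defs
  imports "Graph_Theory.Graph_Theory" "HOL-Library.Extended_Nat"
begin

locale oriented_graph = pair_digraph +
  assumes asym_arcs: "asym (parcs G)"

locale tournament = oriented_graph +
  assumes total_arcs: "total_on (pverts G) (parcs G)"

definition digraph_hom ::
  "('a \<Rightarrow> 'b) \<Rightarrow> 'a pair_pre_digraph \<Rightarrow> 'b pair_pre_digraph \<Rightarrow> bool" where
  "digraph_hom f H T \<longleftrightarrow>
     (\<forall>v \<in> pverts H. f v \<in> pverts T) \<and>
     (\<forall>u v. (u, v) \<in> parcs H \<longrightarrow> (f u, f v) \<in> parcs T)"

text \<open>Vertices of tournaments are taken in \<^typ>\<open>nat\<close>, since a definition cannot quantify over
  types; \<open>maps_to_all_tournaments_transfer\<close> below shows that this is no restriction.\<close>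

definition maps_to_all_tournaments :: "'a pair_pre_digraph \<Rightarrow> nat \<Rightarrow> bool" where
  "maps_to_all_tournaments H n \<longleftrightarrow>
     (\<forall>T :: nat pair_pre_digraph. tournament T \<longrightarrow> card (pverts T) = n \<longrightarrow>
        (\<exists>f. digraph_hom f H T))"

text \<open>In \<^typ>\<open>enat\<close> the infimum of a nonempty set is its least element, and that of the empty
  set is \<open>\<infinity>\<close>.\<close>

definition compressibility :: "'a pair_pre_digraph \<Rightarrow> enat" where
  "compressibility H = Inf {enat n | n. maps_to_all_tournaments H n}"

text \<open>The vertex \<open>v\<^sub>i\<close> is represented by the number \<open>i\<close>.\<close>

definition dpath :: "nat \<Rightarrow> nat \<Rightarrow> nat pair_pre_digraph" where
  "dpath l k =
     \<lparr> pverts = {1..k},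
       parcs = {(i, i + 1) | i. 1 \<le> i \<and> i \<le> k - 1} \<union> {(i, i + l) | i. 1 \<le> i \<and> i \<le> k - l} \<rparr>"

lemma oriented_graph_dpath:
  assumes "2 \<le> l" "l < k"
  shows "oriented_graph (dpath l k)"
proof
  show "finite (pverts (dpath l k))" by (simp add: dpath_def)
  have sub: "parcs (dpath l k) \<subseteq> {1..k} \<times> {1..k}"
    using assms by (auto simp: dpath_def)
  then show "finite (parcs (dpath l k))" by (rule finite_subset) simp
  show "fst e \<in> pverts (dpath l k)" "snd e \<in> pverts (dpath l k)"
    if "e \<in> parcs (dpath l k)" for e
    using sub that by (auto simp: dpath_def)
  show "fst e \<noteq> snd e" if "e \<in> parcs (dpath l k)" for e
    using assms that by (auto simp: dpath_def)
  show "asym (parcs (dpath l k))"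
    by (rule asymI) (use assms in \<open>auto simp: dpath_def\<close>)
qed

lemma maps_to_all_tournaments_transfer:
  fixes T :: "'b pair_pre_digraph"
  assumes H: "maps_to_all_tournaments H (card (pverts T))" and T: "tournament T"
  shows "\<exists>f. digraph_hom f H T"
proof -
  interpret tournament T by (fact T)
  obtain g :: "'b \<Rightarrow> nat" where g: "bij_betw g (pverts T) {0..<card (pverts T)}"
    using ex_bij_betw_finite_nat[OF pair_finite_verts] by blast
  then have inj: "inj_on g (pverts T)" by (rule bij_betw_imp_inj_on)
  define S where "S = \<lparr> pverts = g ` pverts T, parcs = map_prod g g ` parcs T \<rparr>"
  have S: "tournament S"
  proof
    show "finite (pverts S)" "finite (parcs S)"
      by (simp_all add: S_def pair_finite_verts pair_finite_arcs)
    show "fst e \<in> pverts S" "snd e \<in> pverts S" if "e \<in> parcs S" for e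
      using that by (auto simp: S_def wellformed')
    show "fst e \<noteq> snd e" if "e \<in> parcs S" for e
      using that inj pair_no_loops by (fastforce simp: S_def inj_on_eq_iff wellformed')
    show "asym (parcs S)"
    proof (rule asymI)
      fix x y assume "(x, y) \<in> parcs S"
      then obtain u v where uv: "(u, v) \<in> parcs T" "x = g u" "y = g v"
        by (auto simp: S_def)
      show "(y, x) \<notin> parcs S"
      proof
        assume "(y, x) \<in> parcs S"
        then obtain u' v' where uv': "(v', u') \<in> parcs T" "x = g u'" "y = g v'"
          by (auto simp: S_def)
        have "u' = u" "v' = v"
          using inj uv uv' wellformed' by (metis inj_onD)+
        with uv(1) uv'(1) asym_arcs show False by (auto dest: asymD)
      qed
    qed
    show "total_on (pverts S) (parcs S)"
      using total_arcs by (force simp: S_def total_on_def)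
  qed
  have "card (pverts S) = card (pverts T)"
    using inj by (simp add: S_def card_image)
  with H S obtain f where f: "digraph_hom f H S"
    unfolding maps_to_all_tournaments_def by blast
  have "the_inv_into (pverts T) g (g v) = v" if "v \<in> pverts T" for v
    using inj that by (rule the_inv_into_f_f)
  then have "digraph_hom (the_inv_into (pverts T) g) S T"
    unfolding digraph_hom_def S_def by (auto simp: wellformed')
  with f have "digraph_hom (the_inv_into (pverts T) g \<circ> f) H T"
    by (simp add: digraph_hom_def)
  then show ?thesis by blast
qed

end

theory Submission
  imports Defs "HOL-Library.Multiset"
begin

text \<open>Upper bounds. Every tournament has an ordering with the maximum number of forward arcs; in it a
  cyclic triple of consecutive vertices can be rotated without loss, so all three of its vertices
  dominate the next one. Choosing among these orderings one whose cyclic triples lie as far to the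
  right as possible and deleting the last vertex of each cyclic triple leaves the square of a path on
  at least two thirds of the vertices, which settles \<open>l = 2\<close>. For \<open>l \<ge> 4\<close>, either a Hamiltonian path
  works, or it has a backward arc from \<open>v\<^bsub>i+l\<^esub>\<close> to \<open>v\<^sub>i\<close>; this gives a closed walk of length \<open>l - 1\<close>,
  and running around it makes an arc from the \<open>i\<close>-th to the \<open>(i+l)\<close>-th position for free. For \<open>l = 3\<close>
  consider the graph of pairs of vertices without a common out-neighbour. If three vertices cover
  all its edges, delete them: a walk in the remaining tournament ends in a pair that does have a
  common out-neighbour, so it can be extended, and induction yields \<open>3k\<close>. If not, the graph contains four
  disjoint edges or an odd cycle of length \<open>5\<close> or \<open>7\<close>, and each of these carries a closed walk
  that can be run around forever.

  Lower bounds. A walk visits the strong components of a tournament in order, so it suffices to string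
  together copies of a small tournament that admits only short walks: a cyclic triangle for
  \<open>l = 2\<close>, and a suitable tournament on seven vertices, which admits no walk on seven, for \<open>l = 3\<close>.\<close>

section \<open>Pairs without a common out-neighbour\<close>

locale tour =
  fixes V :: "'a set" and A :: "'a \<Rightarrow> 'a \<Rightarrow> bool"
  assumes finite_V: "finite V"
    and asym_A: "A u v \<Longrightarrow> \<not> A v u"
    and total_A: "u \<in> V \<Longrightarrow> v \<in> V \<Longrightarrow> u \<noteq> v \<Longrightarrow> A u v \<or> A v u"
begin

section \<open>Walks and their periodic repetition\<close>

definition walk :: "nat \<Rightarrow> nat \<Rightarrow> (nat \<Rightarrow> 'a) \<Rightarrow> bool" where
  "walk l k f \<longleftrightarrow> (\<forall>i<k. f i \<in> V) \<and> (\<forall>i. i + 1 < k \<longrightarrow> A (f i) (f (i + 1))) \<and>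
     (\<forall>i. i + l < k \<longrightarrow> A (f i) (f (i + l)))"

definition infwalk :: bool where
  "infwalk \<longleftrightarrow> (\<exists>f. \<forall>k. walk 3 k f)"

text \<open>The list is repeated forever; comparing it with its first and third rotations checks all
  arcs, including those across the seam.\<close>

lemma infwalk_periodic:
  assumes "xs \<noteq> []" "set xs \<subseteq> V"
    and "list_all2 A xs (rotate1 xs)" "list_all2 A xs (rotate1 (rotate1 (rotate1 xs)))"
  shows infwalk
proof -
  let ?m = "length xs"
  let ?f = "\<lambda>i. xs ! (i mod ?m)"
  have lt: "i mod ?m < ?m" for i using assms(1) by simp
  have "rotate 3 xs = rotate1 (rotate1 (rotate1 xs))" by (simp add: rotate_def numeral_3_eq_3)
  then have 3: "list_all2 A xs (rotate 3 xs)" using assms(4) by simp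
  have 1: "list_all2 A xs (rotate 1 xs)" using assms(3) by simp
  have "A (?f i) (?f (i + 1))" for i
    using list_all2_nthD[OF 1 lt[of i]] nth_rotate[OF lt, of 1] by (simp add: mod_simps)
  moreover have "A (?f i) (?f (i + 3))" for i
    using list_all2_nthD[OF 3 lt[of i]] nth_rotate[OF lt, of 3] by (simp add: mod_simps add.commute)
  moreover have "?f i \<in> V" for i using assms(2) lt nth_mem by blast
  ultimately have "\<forall>k. walk 3 k ?f" by (simp add: walk_def)
  then show ?thesis unfolding infwalk_def by blast
qed

text \<open>The edges of the domination graph of the reversed tournament: every other vertex
  dominates \<open>a\<close> or \<open>c\<close>.\<close>

definition dpair :: "'a \<Rightarrow> 'a \<Rightarrow> bool" where
  "dpair a c \<longleftrightarrow> a \<in> V \<and> c \<in> V \<and> a \<noteq> c \<and> (\<forall>x\<in>V. \<not> (A a x \<and> A c x))"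

lemma dpair_sym: "dpair a c \<Longrightarrow> dpair c a"
  by (auto simp: dpair_def)

lemma dpairD: "dpair a c \<Longrightarrow> x \<in> V \<Longrightarrow> x \<noteq> a \<Longrightarrow> x \<noteq> c \<Longrightarrow> A x a \<or> A x c"
  using total_A unfolding dpair_def by blast

lemma dpair_no: "dpair a c \<Longrightarrow> x \<in> V \<Longrightarrow> A a x \<Longrightarrow> \<not> A c x"
  by (auto simp: dpair_def)

lemma dpairV: "dpair a c \<Longrightarrow> a \<in> V \<and> c \<in> V \<and> a \<noteq> c"
  by (auto simp: dpair_def)

text \<open>A vertex off the triangle dominates an end of each of its sides, hence at least two of
  its three vertices. Two such vertices dominate a common one, so they form no pair.\<close>

lemma dpair_triangle_cover:
  assumes "dpair x y" "dpair y z" "dpair z x" "dpair a c"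
  shows "{a, c} \<inter> {x, y, z} \<noteq> {}"
proof
  assume *: "{a, c} \<inter> {x, y, z} = {}"
  have "A v x \<and> A v y \<or> A v y \<and> A v z \<or> A v z \<and> A v x" if "v = a \<or> v = c" for v
  proof -
    have v: "v \<in> V" "v \<noteq> x" "v \<noteq> y" "v \<noteq> z" using * that dpairV[OF assms(4)] by auto
    show ?thesis using dpairD[OF assms(1) v(1,2,3)] dpairD[OF assms(2) v(1,3,4)] dpairD[OF assms(3) v(1,4,2)] by blast
  qed
  then have "\<exists>w\<in>{x, y, z}. A a w \<and> A c w" by blast
  moreover have "{x, y, z} \<subseteq> V" using assms dpairV by auto
  ultimately show False using dpair_no[OF assms(4)] by blast
qed

text \<open>Disjoint pairs without common out-neighbours induce an alternating directed 4-cycle: each vertex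
  must dominate some vertex of the other pair, and no vertex is dominated by both.\<close>

definition cross :: "'a \<Rightarrow> 'a \<Rightarrow> 'a \<Rightarrow> 'a \<Rightarrow> bool" where
  "cross p q p' q' \<longleftrightarrow> A p p' \<and> A p' q \<and> A q q' \<and> A q' p"

lemma dpair_cross:
  assumes "dpair p q" "dpair p' q'" "{p, q} \<inter> {p', q'} = {}"
  shows "cross p q p' q' \<or> cross p q q' p'"
proof -
  have n: "p \<noteq> p'" "p \<noteq> q'" "q \<noteq> p'" "q \<noteq> q'" using assms(3) by auto
  note V = dpairV[OF assms(1)] dpairV[OF assms(2)]
  have 1: "A p p' \<or> A p q'" "A q p' \<or> A q q'" using dpairD[OF assms(2)] V n by blast+
  have 2: "A p' p \<or> A p' q" "A q' p \<or> A q' q" using dpairD[OF assms(1)] V n by metis+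
  show ?thesis unfolding cross_def using 1 2 asym_A by metis
qed

lemma cross_flip: "cross p q q' p' \<Longrightarrow> cross p' q' p q"
  by (auto simp: cross_def)

text \<open>Three disjoint pairs form the antipodal pairs \<open>v\<^sub>i, v\<^bsub>i+3\<^esub>\<close> of a circular arrangement in which
  \<open>v\<^sub>i\<close> dominates \<open>v\<^bsub>i+1\<^esub>\<close> and \<open>v\<^bsub>i+2\<^esub>\<close>.\<close>

definition hex :: "'a \<Rightarrow> 'a \<Rightarrow> 'a \<Rightarrow> 'a \<Rightarrow> 'a \<Rightarrow> 'a \<Rightarrow> bool" where
  "hex v0 v1 v2 v3 v4 v5 \<longleftrightarrow> dpair v0 v3 \<and> dpair v1 v4 \<and> dpair v2 v5 \<and>
     cross v0 v3 v1 v4 \<and> cross v0 v3 v2 v5 \<and> cross v1 v4 v2 v5 \<and> distinct [v0, v1, v2, v3, v4, v5]"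

lemma hex_rot: "hex v0 v1 v2 v3 v4 v5 \<Longrightarrow> hex v1 v2 v3 v4 v5 v0"
  by (auto simp: hex_def cross_def dpair_sym)

text \<open>\<open>dpair_cross\<close> orients the second and third pairs relative to the first; how
  these two cross each other decides which of them comes first after \<open>a\<close>.\<close>

lemma ex_hex:
  assumes "dpair a b" "dpair c d" "dpair e f" "distinct [a, b, c, d, e, f]"
  shows "\<exists>p q p' q'. {p, q, p', q'} = {c, d, e, f} \<and> (hex a p q b p' q')"
proof -
  obtain p q where 1: "cross a b p q" "dpair p q" "{p, q} = {c, d}"
    using dpair_cross[OF assms(1,2)] assms(2,4) dpair_sym by fastforce
  obtain p' q' where 2: "cross a b p' q'" "dpair p' q'" "{p', q'} = {e, f}"
    using dpair_cross[OF assms(1,3)] assms(3,4) dpair_sym by fastforce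
  have d: "distinct [a, b, p, q, p', q']" using assms(4) 1(3) 2(3) by (auto simp: doubleton_eq_iff)
  then consider "cross p q p' q'" | "cross p' q' p q"
    using dpair_cross[OF 1(2) 2(2)] cross_flip by auto
  then show ?thesis
  proof cases
    case 1
    then have "hex a p p' b q q'" unfolding hex_def using assms(1) \<open>dpair p q\<close> 2 \<open>cross a b p q\<close> d by auto
    moreover have "{p, p', q, q'} = {c, d, e, f}" using \<open>{p, q} = {c, d}\<close> 2(3) by blast
    ultimately show ?thesis by blast
  next
    case 2
    then have "hex a p' p b q' q" unfolding hex_def
      using assms(1) 1 \<open>dpair p' q'\<close> \<open>cross a b p' q'\<close> d by auto
    moreover have "{p', p, q', q} = {c, d, e, f}" using \<open>{p, q} = {c, d}\<close> \<open>{p', q'} = {e, f}\<close> by blast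
    ultimately show ?thesis by blast
  qed
qed

text \<open>Once oriented relative to \<open>a\<close>, \<open>b\<close>, the other three pairs form
  a tournament under \<open>cross\<close>. A Hamiltonian path in it lists them in the order
  \<open>p2\<close>, \<open>p3\<close>, \<open>p4\<close> of the closed walk on eight vertices in
  \<open>lem\<close>; the cases find this path.\<close>

lemma dpair_matching4:
  assumes "dpair a b" "dpair c d" "dpair e f" "dpair g h" "distinct [a, b, c, d, e, f, g, h]"
  shows infwalk
proof -
  have lem: infwalk
    if c: "hex p p2 p3 q q2 q3" "cross p q p4 q4" "cross p3 q3 p4 q4" "dpair p4 q4"
    for p q p2 q2 p3 q3 p4 q4
  proof (rule infwalk_periodic[of "[p, p2, p3, p4, q, q2, q3, q4]"])
    have V: "p \<in> V" "q \<in> V" "p2 \<in> V" "q2 \<in> V" "p3 \<in> V" "q3 \<in> V" "p4 \<in> V" "q4 \<in> V"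
      using c(1,4) dpairV unfolding hex_def by blast+
    then show "set [p, p2, p3, p4, q, q2, q3, q4] \<subseteq> V" by simp
  qed (use c(1-3) in \<open>simp_all add: hex_def cross_def\<close>)
  obtain p q p' q' where 1: "{p, q, p', q'} = {c, d, e, f}" "hex a p q b p' q'"
    using ex_hex[OF assms(1-3)] assms(5) by auto
  obtain r s where 2: "cross a b r s" "dpair r s" "{r, s} = {g, h}"
    using dpair_cross[OF assms(1,4)] assms(4,5) dpair_sym by fastforce
  have d: "{r, s} \<inter> {a, b, p, q, p', q'} = {}" using 1(1) 2(3) assms(5) by (auto simp: doubleton_eq_iff)
  have ab: "dpair p p'" "dpair q q'" "cross a b p p'" "cross a b q q'" "cross p p' q q'" "dpair a b"
    "distinct [a, b, p, q, p', q']"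
    using 1(2) by (auto simp: hex_def)
  have pr: "cross p p' r s \<or> cross r s p p'" using dpair_cross[OF ab(1) 2(2)] d cross_flip by auto
  have qr: "cross q q' r s \<or> cross r s q q'" using dpair_cross[OF ab(2) 2(2)] d cross_flip by auto
  have d2: "distinct [a, b, p, q, p', q', r, s]" using d ab(7) dpairV[OF 2(2)] by auto
  show infwalk
  proof (cases "cross q q' r s")
    case True
    then show ?thesis using lem[of a p q b p' q' r s] 1(2) 2 by auto
  next
    case False
    then have F: "cross r s q q'" using qr by blast
    show ?thesis
    proof (cases "cross p p' r s")
      case True
      have "hex a p r b p' s" using True ab 2 d2 by (auto simp: hex_def)
      then show ?thesis using lem[of a p r b p' s q q'] F ab by auto
    next
      case False
      then have "cross r s p p'" using pr by blast
      then have "hex a r p b s p'" using ab 2 d2 by (auto simp: hex_def)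
      then show ?thesis using lem[of a r p b s p' q q'] ab by auto
    qed
  qed
qed

text \<open>Reflecting the 5-cycle if necessary, assume \<open>A v1 v3\<close>. Each known arc then
  forces the next, until the five vertices form the rotational tournament, around which a walk can
  run.\<close>

lemma dpair_cycle5:
  assumes "dpair v1 v2" "dpair v2 v3" "dpair v3 v4" "dpair v4 v5" "dpair v5 v1"
    and "distinct [v1, v2, v3, v4, v5]"
  shows infwalk
proof -
  have lem: infwalk
    if d: "dpair v1 v2" "dpair v2 v3" "dpair v3 v4" "dpair v4 v5" "dpair v5 v1"
      "distinct [v1, v2, v3, v4, v5]" "A v1 v3"
    for v1 v2 v3 v4 v5
  proof -
    have V: "v1 \<in> V" "v2 \<in> V" "v3 \<in> V" "v4 \<in> V" "v5 \<in> V" using d dpairV by blast+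
    have 1: "A v3 v2 \<or> A v3 v1" using dpairD[OF d(1)] V d(6) by auto
    have 2: "A v3 v5" using dpairD[OF d(5), of v3] asym_A V d(6,7) by auto
    have 3: "A v5 v2" using dpairD[OF d(2), of v5] asym_A V d(6) 2 by auto
    have 4: "A v2 v4" using dpairD[OF d(4), of v2] asym_A V d(6) 3 by auto
    have 5: "A v4 v1" using dpairD[OF d(1), of v4] asym_A V d(6) 4 by auto
    have 6: "A v3 v2" using 1 d(7) asym_A by blast
    have 7: "A v1 v5" using dpairD[OF d(4), of v1] asym_A V d(6) 5 by auto
    have 8: "A v5 v4" using dpairD[OF d(3), of v5] asym_A V d(6) 2 by auto
    have 9: "A v4 v3" using dpairD[OF d(2), of v4] asym_A V d(6) 4 by auto
    have 10: "A v2 v1" using dpairD[OF d(5), of v2] asym_A V d(6) 3 by auto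
    show infwalk
      by (rule infwalk_periodic[of "[v1, v5, v4, v3, v2]"])
        (use V 2 3 4 5 6 7 8 9 10 d(7) in simp_all)
  qed
  have "A v1 v3 \<or> A v3 v1" using total_A dpairV assms by (metis distinct_length_2_or_more)
  then show ?thesis
    using lem[OF assms(1-6)] assms(6)
      lem[OF dpair_sym[OF assms(2)] dpair_sym[OF assms(1)] dpair_sym[OF assms(5)] dpair_sym[OF assms(4)]
        dpair_sym[OF assms(3)]] by auto
qed

lemma hexD:
  assumes "hex v0 v1 v2 v3 v4 v5"
  shows "dpair v0 v3" "dpair v1 v4" "dpair v2 v5"
    "A v0 v1" "A v1 v2" "A v2 v3" "A v3 v4" "A v4 v5" "A v5 v0"
    "A v0 v2" "A v1 v3" "A v2 v4" "A v3 v5" "A v4 v0" "A v5 v1"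
    "distinct [v0, v1, v2, v3, v4, v5]"
    "v0 \<in> V" "v1 \<in> V" "v2 \<in> V" "v3 \<in> V" "v4 \<in> V" "v5 \<in> V"
  using assms dpairV by (auto simp: hex_def cross_def)

section \<open>Covering all pairs by three vertices\<close>

definition outer :: "'a set \<Rightarrow> 'a \<Rightarrow> bool" where
  "outer H v \<longleftrightarrow> (\<exists>x. x \<notin> H \<and> dpair x v)"

context
  assumes ninf: "\<not> infwalk"
    and ntri: "\<And>x y z. dpair x y \<Longrightarrow> dpair y z \<Longrightarrow> dpair z x \<Longrightarrow> False"
begin

text \<open>A common outside partner would give a triangle with \<open>v0\<close>,
  \<open>v3\<close>; different ones give four disjoint pairs.\<close>

lemma hex_outer_antipodal:
  assumes "hex v0 v1 v2 v3 v4 v5" "H = {v0, v1, v2, v3, v4, v5}"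
  shows "\<not> (outer H v0 \<and> outer H v3)"
proof
  note h = hexD[OF assms(1)]
  assume "outer H v0 \<and> outer H v3"
  then obtain x y where xy: "x \<notin> H" "y \<notin> H" "dpair x v0" "dpair y v3" unfolding outer_def by blast
  have "x \<noteq> y" using ntri[OF xy(3) h(1)] xy(4) dpair_sym by blast
  then show False using dpair_matching4[OF xy(3,4) h(2,3)] h(16) xy(1,2) assms(2) ninf by auto
qed

text \<open>However the arc between \<open>v0\<close> and \<open>v3\<close> points, its head is a
  common out-neighbour, of \<open>v0\<close>, \<open>v2\<close> or of \<open>v3\<close>,
  \<open>v5\<close>.\<close>

lemma hex_inner_antipodal:
  assumes "hex v0 v1 v2 v3 v4 v5"
  shows "\<not> (dpair v0 v2 \<and> dpair v3 v5)"
proof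
  note h = hexD[OF assms(1)]
  assume *: "dpair v0 v2 \<and> dpair v3 v5"
  have "A v0 v3 \<or> A v3 v0" using total_A h(16-22) by auto
  then show False using * dpair_no h by blast
qed

text \<open>With two antipodal pairs these close up to the 5-cycle \<open>v0\<close>,
  \<open>v2\<close>, \<open>v4\<close>, \<open>v1\<close>, \<open>v3\<close>.\<close>

lemma hex_inner_consecutive:
  assumes "hex v0 v1 v2 v3 v4 v5"
  shows "\<not> (dpair v0 v2 \<and> dpair v1 v3 \<and> dpair v2 v4)"
proof
  note h = hexD[OF assms]
  assume "dpair v0 v2 \<and> dpair v1 v3 \<and> dpair v2 v4"
  then have "dpair v0 v2" "dpair v2 v4" "dpair v1 v3" by blast+
  from dpair_cycle5[OF this(1,2) dpair_sym[OF h(2)] this(3) dpair_sym[OF h(1)]] h(16) ninf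
  show False by auto
qed

text \<open>A common outside partner \<open>x\<close> closes the 5-cycle \<open>x\<close>,
  \<open>v3\<close>, \<open>v0\<close>, \<open>v2\<close>, \<open>v5\<close>; different ones give
  four disjoint pairs.\<close>

lemma hex_outer_inner:
  assumes "hex v0 v1 v2 v3 v4 v5" "H = {v0, v1, v2, v3, v4, v5}"
  shows "\<not> (outer H v3 \<and> dpair v0 v2 \<and> outer H v5)"
proof
  note h = hexD[OF assms(1)]
  assume *: "outer H v3 \<and> dpair v0 v2 \<and> outer H v5"
  then obtain x y where xy: "x \<notin> H" "y \<notin> H" "dpair x v3" "dpair y v5" unfolding outer_def by blast
  have d: "distinct [x, v3, v0, v2, v5]" using xy h(16) assms(2) by auto
  have "x \<noteq> y" using dpair_cycle5[OF xy(3) _ _ h(3) _ d] dpair_sym h * xy ninf by blast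
  then show False using dpair_matching4[OF xy(3,4) h(2), of v0 v2] h(16) xy(1,2) assms(2) ninf * by auto
qed

text \<open>Different outside partners give four disjoint pairs. A common one, \<open>x\<close>,
  closes the 7-cycle \<open>x\<close>, \<open>v5\<close>, \<open>v2\<close>, \<open>v0\<close>,
  \<open>v3\<close>, \<open>v1\<close>, \<open>v4\<close>, which forces every arc of a closed walk
  on these seven vertices.\<close>

lemma hex_outer_inner2:
  assumes "hex v0 v1 v2 v3 v4 v5" "H = {v0, v1, v2, v3, v4, v5}"
  shows "\<not> (outer H v5 \<and> outer H v4 \<and> dpair v0 v2 \<and> dpair v1 v3)"
proof
  note h = hexD[OF assms(1)]
  assume *: "outer H v5 \<and> outer H v4 \<and> dpair v0 v2 \<and> dpair v1 v3"
  then obtain x y where xy: "x \<notin> H" "y \<notin> H" "dpair x v5" "dpair y v4" unfolding outer_def by blast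
  have n: "x \<noteq> v0" "x \<noteq> v1" "x \<noteq> v2" "x \<noteq> v3" "x \<noteq> v4" "x \<noteq> v5" using xy assms(2) by auto
  have V: "x \<in> V" using xy dpairV by blast
  have "x \<noteq> y"
  proof
    assume "x = y"
    then have d: "dpair x v4" "dpair x v5" using xy by auto
    have nd: "A v0 v3 \<or> A v3 v0" "A v1 v4 \<or> A v4 v1" using total_A h(16-22) by auto
    have 1: "A v3 v0" using nd(1) * h dpair_no by blast
    have 2: "A v4 v1" using nd(2) * h dpair_no by blast
    have xs: "A v0 x" "A v1 x" "A x v3"
    proof -
      show "A v0 x" using dpairD[OF d(2), of v0] h n asym_A by auto
      show "A v1 x" using dpairD[OF d(2), of v1] h n dpair_no by (metis distinct_length_2_or_more asym_A)
      show "A x v3" using dpairD[OF hexD(1)[OF assms(1)] V] n \<open>A v0 x\<close> asym_A by blast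
    qed
    have "A x v4" using dpairD[OF hexD(2)[OF assms(1)] V] n xs asym_A by blast
    moreover have "A x v2" using dpairD[of v0 v2 x] * V n xs asym_A by blast
    moreover have "A v5 x" using dpairD[OF d(1), of v5] h n asym_A by auto
    moreover have "A v2 v5"
    proof -
      have "A v2 v5 \<or> A v5 v2" using total_A h(16-22) by auto
      moreover have "A v2 x \<or> A v2 v5" using dpairD[OF d(2), of v2] h n by auto
      ultimately show ?thesis using \<open>A x v2\<close> asym_A by blast
    qed
    ultimately have infwalk
      using infwalk_periodic[of "[v0, v1, x, v2, v3, v4, v5]"] h V xs 1 2 by simp
    then show False using ninf by simp
  qed
  then show False
    using dpair_matching4[OF xy(3,4), of v0 v2 v1 v3] h(16) xy(1,2) assms(2) ninf * by auto
qed

lemma hex_cover: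
  assumes h: "hex v0 v1 v2 v3 v4 v5"
  shows "\<exists>R. R \<subseteq> V \<and> card R \<le> 3 \<and> (\<forall>a c. dpair a c \<longrightarrow> a \<in> R \<or> c \<in> R)"
proof (rule ccontr)
  assume nc: "\<nexists>R. R \<subseteq> V \<and> card R \<le> 3 \<and> (\<forall>a c. dpair a c \<longrightarrow> a \<in> R \<or> c \<in> R)"
  define H where "H = {v0, v1, v2, v3, v4, v5}"
  note h1 = hex_rot[OF h] note h2 = hex_rot[OF h1] note h3 = hex_rot[OF h2]
  note h4 = hex_rot[OF h3] note h5 = hex_rot[OF h4]
  have H: "H = {v1, v2, v3, v4, v5, v0}" "H = {v2, v3, v4, v5, v0, v1}" "H = {v3, v4, v5, v0, v1, v2}"
    "H = {v4, v5, v0, v1, v2, v3}" "H = {v5, v0, v1, v2, v3, v4}" by (auto simp: H_def)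
  note hd = hexD[OF h]
  \<comment> \<open>Consecutive vertices both dominate the one after them, so only antipodal
    vertices and vertices two apart can form pairs inside the hexagon.\<close>
  have nocons: "\<not> dpair v0 v1" "\<not> dpair v1 v2" "\<not> dpair v2 v3" "\<not> dpair v3 v4" "\<not> dpair v4 v5" "\<not> dpair v5 v0"
    using hd dpair_no by blast+
  have meets: "a \<in> H \<or> c \<in> H" if "dpair a c" for a c
  proof (rule ccontr)
    assume "\<not> (a \<in> H \<or> c \<in> H)"
    then show False
      using dpair_matching4[OF that hd(1-3)] hd(16) dpairV[OF that] ninf by (auto simp: H_def)
  qed
  have key: "outer H c1 \<or> outer H c2 \<or> outer H c3 \<or> dpair c1 c2 \<or> dpair c2 c3 \<or> dpair c1 c3"
    if r: "{r1, r2, r3} \<union> {c1, c2, c3} = H" for r1 r2 r3 c1 c2 c3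
  proof -
    have "H \<subseteq> V" using hd(17-22) by (simp add: H_def)
    then have "{r1, r2, r3} \<subseteq> V" using r by blast
    moreover have "card {r1, r2, r3} \<le> 3" by (simp add: card_insert_if)
    ultimately obtain a c where ac: "dpair a c" "a \<notin> {r1, r2, r3}" "c \<notin> {r1, r2, r3}" using nc by blast
    have "a \<in> {c1, c2, c3} \<or> c \<in> {c1, c2, c3}" using meets[OF ac(1)] ac r by blast
    moreover have "a \<in> {c1, c2, c3} \<or> a \<notin> H" "c \<in> {c1, c2, c3} \<or> c \<notin> H" using ac r by blast+
    ultimately show ?thesis using ac(1) dpair_sym[OF ac(1)] dpairV[OF ac(1)] unfolding outer_def by blast
  qed
  \<comment> \<open>\<open>key\<close> says that no transversal of the three antipodal pairs is a cover; together with the preceding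
    lemmas for all six rotations this is propositionally unsatisfiable.\<close>
  define o0 where "o0 = outer H v0" define o1 where "o1 = outer H v1" define o2 where "o2 = outer H v2"
  define o3 where "o3 = outer H v3" define o4 where "o4 = outer H v4" define o5 where "o5 = outer H v5"
  define n0 where "n0 = dpair v0 v2" define n1 where "n1 = dpair v1 v3" define n2 where "n2 = dpair v2 v4"
  define n3 where "n3 = dpair v3 v5" define n4 where "n4 = dpair v4 v0" define n5 where "n5 = dpair v5 v1"
  have k: "o0 \<or> o1 \<or> o2 \<or> n0" "o1 \<or> o2 \<or> o3 \<or> n1" "o2 \<or> o3 \<or> o4 \<or> n2" "o3 \<or> o4 \<or> o5 \<or> n3"
    "o4 \<or> o5 \<or> o0 \<or> n4" "o5 \<or> o0 \<or> o1 \<or> n5" "o0 \<or> o2 \<or> o4 \<or> n0 \<or> n2 \<or> n4" "o1 \<or> o3 \<or> o5 \<or> n1 \<or> n3 \<or> n5"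
    unfolding o0_def o1_def o2_def o3_def o4_def o5_def n0_def n1_def n2_def n3_def n4_def n5_def
    using key[of v3 v4 v5 v0 v1 v2] key[of v4 v5 v0 v1 v2 v3] key[of v5 v0 v1 v2 v3 v4]
      key[of v0 v1 v2 v3 v4 v5] key[of v1 v2 v3 v4 v5 v0] key[of v2 v3 v4 v5 v0 v1]
      key[of v1 v3 v5 v0 v2 v4] key[of v0 v2 v4 v1 v3 v5] nocons dpair_sym
    by (auto simp: H_def)
  note d = o0_def o1_def o2_def o3_def o4_def o5_def n0_def n1_def n2_def n3_def n4_def n5_def
  have c1: "\<not> (o0 \<and> o3)" "\<not> (o1 \<and> o4)" "\<not> (o2 \<and> o5)"
    using hex_outer_antipodal[OF h H_def] hex_outer_antipodal[OF h1 H(1)] hex_outer_antipodal[OF h2 H(2)]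
    by (auto simp: d)
  have c2: "\<not> (n0 \<and> n3)" "\<not> (n1 \<and> n4)" "\<not> (n2 \<and> n5)"
    using hex_inner_antipodal[OF h] hex_inner_antipodal[OF h1] hex_inner_antipodal[OF h2] by (auto simp: d)
  have c3: "\<not> (n0 \<and> n1 \<and> n2)" "\<not> (n1 \<and> n2 \<and> n3)" "\<not> (n2 \<and> n3 \<and> n4)" "\<not> (n3 \<and> n4 \<and> n5)"
    "\<not> (n4 \<and> n5 \<and> n0)" "\<not> (n5 \<and> n0 \<and> n1)"
    using hex_inner_consecutive[OF h] hex_inner_consecutive[OF h1] hex_inner_consecutive[OF h2]
      hex_inner_consecutive[OF h3] hex_inner_consecutive[OF h4] hex_inner_consecutive[OF h5]
    by (auto simp: d)
  have c4: "\<not> (n0 \<and> n2 \<and> n4)" "\<not> (n1 \<and> n3 \<and> n5)" using ntri by (auto simp: d)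
  have c5: "\<not> (o3 \<and> n0 \<and> o5)" "\<not> (o4 \<and> n1 \<and> o0)" "\<not> (o5 \<and> n2 \<and> o1)" "\<not> (o0 \<and> n3 \<and> o2)"
    "\<not> (o1 \<and> n4 \<and> o3)" "\<not> (o2 \<and> n5 \<and> o4)"
    using hex_outer_inner[OF h H_def] hex_outer_inner[OF h1 H(1)] hex_outer_inner[OF h2 H(2)]
      hex_outer_inner[OF h3 H(3)] hex_outer_inner[OF h4 H(4)] hex_outer_inner[OF h5 H(5)]
    by (auto simp: d)
  have c6: "\<not> (o5 \<and> o4 \<and> n0 \<and> n1)" "\<not> (o0 \<and> o5 \<and> n1 \<and> n2)" "\<not> (o1 \<and> o0 \<and> n2 \<and> n3)"
    "\<not> (o2 \<and> o1 \<and> n3 \<and> n4)" "\<not> (o3 \<and> o2 \<and> n4 \<and> n5)" "\<not> (o4 \<and> o3 \<and> n5 \<and> n0)"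
    using hex_outer_inner2[OF h H_def] hex_outer_inner2[OF h1 H(1)] hex_outer_inner2[OF h2 H(2)]
      hex_outer_inner2[OF h3 H(3)] hex_outer_inner2[OF h4 H(4)] hex_outer_inner2[OF h5 H(5)]
    by (auto simp: d)
  from k c1 c2 c3 c4 c5 c6 show False by sat
qed

end

text \<open>A triangle is itself a cover, and three disjoint pairs yield a hexagon. Otherwise, if no
  cover existed, two disjoint pairs \<open>a\<close>, \<open>b\<close> and \<open>c\<close>,
  \<open>d\<close> could be augmented along a path \<open>x\<close>, \<open>a\<close>,
  \<open>b\<close>, \<open>y\<close> to three.\<close>

lemma dpair_cover:
  assumes "\<not> infwalk"
  shows "\<exists>R. R \<subseteq> V \<and> card R \<le> 3 \<and> (\<forall>a c. dpair a c \<longrightarrow> a \<in> R \<or> c \<in> R)"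
proof (cases "\<exists>x y z. dpair x y \<and> dpair y z \<and> dpair z x")
  case True
  then obtain x y z where t: "dpair x y" "dpair y z" "dpair z x" by blast
  have "card {x, y, z} \<le> 3" by (simp add: card_insert_if)
  moreover have "{x, y, z} \<subseteq> V" using t dpairV by blast
  ultimately show ?thesis using dpair_triangle_cover[OF t] by (intro exI[of _ "{x, y, z}"]) blast
next
  case False
  then have ntri: "\<And>x y z. dpair x y \<Longrightarrow> dpair y z \<Longrightarrow> dpair z x \<Longrightarrow> False" by blast
  show ?thesis
  proof (cases "\<exists>a b c d e f. dpair a b \<and> dpair c d \<and> dpair e f \<and> distinct [a, b, c, d, e, f]")
    case True
    then obtain a b c d e f where "dpair a b" "dpair c d" "dpair e f" "distinct [a, b, c, d, e, f]"
      by blast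
    from ex_hex[OF this] obtain p q p' q' where "hex a p q b p' q'" by blast
    from hex_cover[OF assms ntri this] show ?thesis .
  next
    case False
    have small: "\<exists>u v. dpair u v \<and> u \<notin> set xs \<and> v \<notin> set xs"
      if nc: "\<not> ?thesis" and xs: "set xs \<subseteq> V" "length xs \<le> 3" for xs
    proof (rule ccontr)
      assume "\<not> ?thesis"
      moreover have "card (set xs) \<le> 3" using card_length[of xs] xs(2) by linarith
      ultimately show False using nc xs(1) by blast
    qed
    show ?thesis
    proof (rule ccontr)
      assume nc: "\<not> ?thesis"
      obtain a b where ab: "dpair a b" using small[OF nc, of "[]"] by auto
      obtain c d where cd: "dpair c d" "c \<notin> {a, b}" "d \<notin> {a, b}"
        using small[OF nc, of "[a, b]"] dpairV[OF ab] by auto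
      note V = dpairV[OF ab] dpairV[OF cd(1)]
      have meets: "u \<in> {a, b, c, d} \<or> v \<in> {a, b, c, d}" if "dpair u v" for u v
      proof (rule ccontr)
        assume "\<not> ?thesis"
        then have "distinct [a, b, c, d, u, v]" using cd V dpairV[OF that] by auto
        then show False using False ab cd(1) that by blast
      qed
      \<comment> \<open>A pair avoiding \<open>b\<close>, \<open>c\<close>, \<open>d\<close> still
        meets \<open>a\<close>, \<open>b\<close>, \<open>c\<close>, \<open>d\<close>, so it contains
        \<open>a\<close> and its other end is new.\<close>
      obtain x where x: "dpair x a" "x \<notin> {a, b, c, d}"
      proof -
        obtain u v where uv: "dpair u v" "u \<notin> {b, c, d}" "v \<notin> {b, c, d}"
          using small[OF nc, of "[b, c, d]"] V by auto
        then show ?thesis using that meets[OF uv(1)] dpair_sym[OF uv(1)] dpairV[OF uv(1)] by blast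
      qed
      obtain y where y: "dpair y b" "y \<notin> {a, b, c, d}"
      proof -
        obtain u v where uv: "dpair u v" "u \<notin> {a, c, d}" "v \<notin> {a, c, d}"
          using small[OF nc, of "[a, c, d]"] V by auto
        then show ?thesis using that meets[OF uv(1)] dpair_sym[OF uv(1)] dpairV[OF uv(1)] by blast
      qed
      have "x \<noteq> y" using ntri[OF x(1) ab] dpair_sym[OF y(1)] by blast
      then have "distinct [x, a, y, b, c, d]" using x y cd V by auto
      then show False using False x(1) y(1) cd(1) by blast
    qed
  qed
qed

end


lemma successively_cyclic_append:
  assumes "successively A (x # us @ [x])" "successively A (x # vs @ [x])"
  shows "successively A (x # (us @ x # vs) @ [x])"
proof -
  have "successively A ((x # us) @ [x])" "successively A (x # (vs @ [x]))" using assms by auto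
  then have "successively A ((x # us) @ (x # vs @ [x]))"
    unfolding successively_append_iff by (auto simp: successively_Cons)
  then show ?thesis by simp
qed

lemma finite_ex_greatest:
  fixes f :: "'b \<Rightarrow> nat"
  assumes "finite S" "S \<noteq> {}"
  shows "\<exists>x\<in>S. \<forall>y\<in>S. f y \<le> f x"
proof -
  have "Max (f ` S) \<in> f ` S" using assms by simp
  then obtain x where "x \<in> S" "f x = Max (f ` S)" by auto
  then show ?thesis using assms(1) by (intro bexI[of _ x]) auto
qed

section \<open>Median orders\<close>

context tour
begin

primrec fwd :: "'a list \<Rightarrow> nat" where
  "fwd [] = 0"
| "fwd (x # xs) = length (filter (A x) xs) + fwd xs"

definition fwd_between :: "'a list \<Rightarrow> 'a list \<Rightarrow> nat" where
  "fwd_between xs ys = (\<Sum>x\<leftarrow>xs. length (filter (A x) ys))"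

lemma fwd_append: "fwd (xs @ ys) = fwd xs + fwd ys + fwd_between xs ys"
  by (induction xs) (auto simp: fwd_between_def)

lemma fwd_between_cong:
  assumes "mset xs = mset xs'" "mset ys = mset ys'"
  shows "fwd_between xs ys = fwd_between xs' ys'"
proof -
  have "length (filter P ys) = length (filter P ys')" for P
    using assms(2) by (metis mset_filter size_mset)
  moreover have "(\<Sum>x\<leftarrow>xs. g x) = (\<Sum>x\<leftarrow>xs'. g x)" for g :: "'a \<Rightarrow> nat"
    using assms(1) by (metis mset_map sum_mset_sum_list)
  ultimately show ?thesis by (simp add: fwd_between_def)
qed

lemma fwd_replace:
  assumes "mset vs = mset vs'"
  shows "fwd (us @ vs @ ws) + fwd vs' = fwd (us @ vs' @ ws) + fwd vs"
  using fwd_between_cong[of us us "vs @ ws" "vs' @ ws"] fwd_between_cong[of vs vs' ws ws] assms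
  by (simp add: fwd_append)

text \<open>The indicator sequence of the cyclic triples read as a binary number, rightmost triple most
  significant.\<close>

fun tri_weight :: "'a list \<Rightarrow> nat" where
  "tri_weight (a # b # c # xs) = (if A c a then 1 else 0) + 2 * tri_weight (b # c # xs)"
| "tri_weight _ = 0"

lemma tri_weight_Cons: "tri_weight (x # xs) = 2 * tri_weight xs \<or> tri_weight (x # xs) = 2 * tri_weight xs + 1"
  by (cases "x # xs" rule: tri_weight.cases) auto

text \<open>The triples starting in the prefix only supply lower binary digits, which cannot
  outweigh the suffix.\<close>

lemma tri_weight_append_less:
  assumes "length us = length us'" "tri_weight zs < tri_weight zs'"
  shows "tri_weight (us @ zs) < tri_weight (us' @ zs')"
  using assms(1)
proof (induction us us' rule: list_induct2)
  case Nil
  then show ?case using assms(2) by simp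
next
  case (Cons x xs y ys)
  then show ?case using tri_weight_Cons[of x "xs @ zs"] tri_weight_Cons[of y "ys @ zs'"] by auto
qed

definition order_of :: "'a list \<Rightarrow> bool" where
  "order_of xs \<longleftrightarrow> distinct xs \<and> set xs = V"

definition median :: "'a list \<Rightarrow> bool" where
  "median xs \<longleftrightarrow> order_of xs \<and> (\<forall>ys. order_of ys \<longrightarrow> fwd ys \<le> fwd xs)"

lemma order_of_cong: "mset xs = mset ys \<Longrightarrow> order_of xs \<Longrightarrow> order_of ys"
  unfolding order_of_def using mset_eq_imp_distinct_iff mset_eq_setD by blast

lemma median_replace_le:
  assumes "median (us @ vs @ ws)" "mset vs = mset vs'"
  shows "fwd vs' \<le> fwd vs"
proof -
  have "order_of (us @ vs' @ ws)"
    using assms order_of_cong[of "us @ vs @ ws" "us @ vs' @ ws"] by (simp add: median_def)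
  then have "fwd (us @ vs' @ ws) \<le> fwd (us @ vs @ ws)" using assms(1) by (simp add: median_def)
  then show ?thesis using fwd_replace[OF assms(2), of us ws] by linarith
qed

lemma median_replace:
  assumes "median (us @ vs @ ws)" "mset vs = mset vs'" "fwd vs' = fwd vs"
  shows "median (us @ vs' @ ws)"
proof -
  have "order_of (us @ vs' @ ws)"
    using assms order_of_cong[of "us @ vs @ ws" "us @ vs' @ ws"] by (simp add: median_def)
  moreover have "fwd (us @ vs' @ ws) = fwd (us @ vs @ ws)"
    using fwd_replace[OF assms(2), of us ws] assms(3) by linarith
  ultimately show ?thesis using assms(1) by (simp add: median_def)
qed

lemma median_in: "median (us @ vs @ ws) \<Longrightarrow> set vs \<subseteq> V \<and> distinct vs"
  by (auto simp: median_def order_of_def)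

text \<open>Otherwise swapping the two neighbours would gain a forward arc.\<close>

lemma median_consec:
  assumes "median (us @ a # b # ws)"
  shows "A a b"
proof -
  have m: "median (us @ [a, b] @ ws)" using assms by simp
  have "fwd [b, a] \<le> fwd [a, b]" by (rule median_replace_le[OF m]) simp
  then show ?thesis using total_A[of a b] median_in[OF m] by (auto split: if_splits)
qed

text \<open>All rotations of a cyclic triple have two forward arcs.\<close>

lemma median_rotate:
  assumes "median (us @ a # b # c # ws)" "A c a"
  shows "median (us @ b # c # a # ws)"
proof -
  have m: "median (us @ [a, b, c] @ ws)" using assms by simp
  have "A a b" using median_consec[of us a b] m by simp
  moreover have "A b c" using median_consec[of "us @ [a]" b c] m by simp
  ultimately have "fwd [b, c, a] = fwd [a, b, c]" using assms(2) asym_A by auto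
  then have "median (us @ [b, c, a] @ ws)" by (intro median_replace[OF m]) auto
  then show ?thesis by simp
qed

lemma median_rotate2:
  assumes "median (us @ a # b # c # ws)" "A c a"
  shows "median (us @ c # a # b # ws)"
  using median_rotate[OF median_rotate[OF assms]] median_consec[of us a b] assms by auto

text \<open>Rotation brings \<open>a\<close> or \<open>b\<close> directly in front of
  \<open>d\<close>, where \<open>median_consec\<close> applies.\<close>

lemma median_after_triangle:
  assumes "median (us @ a # b # c # d # ws)" "A c a"
  shows "A a d" "A b d"
  using median_consec[of "us @ [b, c]" a d] median_rotate[OF assms]
    median_consec[of "us @ [c, a]" b d] median_rotate2[OF assms] by auto

lemma median_before_triangle:
  assumes "median (us @ z # a # b # c # ws)" "A c a"
  shows "A z c"
proof -
  have "median ((us @ [z]) @ a # b # c # ws)" using assms by simp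
  from median_rotate2[OF this assms(2)] show ?thesis using median_consec[of us z c] by simp
qed

section \<open>Squares of paths from optimal median orders\<close>

definition opt_median :: "'a list \<Rightarrow> bool" where
  "opt_median xs \<longleftrightarrow> median xs \<and> (\<forall>ys. median ys \<longrightarrow> tri_weight ys \<le> tri_weight xs)"

lemma opt_median_exists: "\<exists>xs. opt_median xs"
proof -
  have fin: "finite {xs. order_of xs}"
    unfolding order_of_def by (rule finite_subset[OF _ finite_subset_distinct[OF finite_V]]) auto
  have ne: "\<exists>xs. order_of xs" unfolding order_of_def using finite_distinct_list[OF finite_V] by blast
  have ne2: "\<exists>xs. median xs" unfolding median_def
    using finite_ex_greatest[OF fin, of fwd] ne by auto
  have fin2: "finite {xs. median xs}" using fin by (rule rev_finite_subset) (auto simp: median_def)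
  show ?thesis unfolding opt_median_def
    using finite_ex_greatest[OF fin2, of tri_weight] ne2 by auto
qed

text \<open>Otherwise \<open>b\<close>, \<open>d\<close>, \<open>e\<close> is cyclic while
  \<open>c\<close>, \<open>d\<close>, \<open>e\<close> is not, by
  \<open>median_before_triangle\<close>. Rotating the first triple to \<open>c\<close>,
  \<open>a\<close>, \<open>b\<close> thus creates a cyclic triple and changes only less significant
  digits besides, so the weight grows.\<close>

lemma opt_median_skip:
  assumes "opt_median (us @ a # b # c # d # e # ws)" "A c a"
  shows "A b e"
proof (rule ccontr)
  assume nbe: "\<not> A b e"
  have m: "median (us @ a # b # c # d # e # ws)" using assms(1) by (simp add: opt_median_def)
  have V: "b \<in> V" "c \<in> V" "e \<in> V" "b \<noteq> e" "c \<noteq> e"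
    using median_in[of us "[a, b, c, d, e]" ws] m by auto
  have "\<not> A e c"
    using median_before_triangle[of "us @ [a]" b c d e ws] m nbe by auto
  moreover have "A e b" using nbe V total_A by blast
  ultimately have "tri_weight (c # d # e # ws) < tri_weight (b # d # e # ws)" by simp
  then have "tri_weight ((us @ [a, b]) @ c # d # e # ws) < tri_weight ((us @ [c, a]) @ b # d # e # ws)"
    by (intro tri_weight_append_less) auto
  moreover have "median (us @ c # a # b # d # e # ws)" using median_rotate2[OF m assms(2)] .
  ultimately show False using assms(1) unfolding opt_median_def by (metis append_Cons append_Nil append_assoc leD)
qed

text \<open>The scan resumes behind a triple that has lost its last vertex. These triples are
  therefore disjoint, and at least two thirds of the vertices survive.\<close>

fun keep :: "'a list \<Rightarrow> 'a list" where
  "keep (a # b # c # xs) = (if A c a then a # b # keep xs else a # keep (b # c # xs))"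
| "keep xs = xs"

lemma length_keep: "2 * length xs \<le> 3 * length (keep xs)"
  by (induction xs rule: keep.induct) auto

lemma set_keep: "set (keep xs) \<subseteq> set xs"
  by (induction xs rule: keep.induct) auto

lemma keep_Cons2: "\<exists>ys. keep (a # b # xs) = a # b # ys"
proof -
  have 1: "\<exists>ys. keep (u # us) = u # ys" for u us by (cases "u # us" rule: keep.cases) auto
  show ?thesis using 1[of b] by (cases xs) auto
qed

fun square_path :: "'a list \<Rightarrow> bool" where
  "square_path (a # b # c # xs) \<longleftrightarrow> A a b \<and> A a c \<and> square_path (b # c # xs)"
| "square_path [a, b] \<longleftrightarrow> A a b"
| "square_path _ \<longleftrightarrow> True"

lemma square_path_ConsI:
  "square_path (b # xs) \<Longrightarrow> A a b \<Longrightarrow> (\<And>c ys. xs = c # ys \<Longrightarrow> A a c) \<Longrightarrow> square_path (a # b # xs)"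
  by (cases xs) auto

text \<open>When \<open>c\<close> is deleted, \<open>a\<close> and \<open>b\<close> dominate the
  next vertex \<open>d\<close> by \<open>median_after_triangle\<close>, and \<open>b\<close>
  dominates its successor \<open>e\<close> by \<open>opt_median_skip\<close>; both \<open>d\<close>
  and \<open>e\<close> survive. The prefix \<open>us\<close> is carried along because optimality
  concerns the whole order.\<close>

lemma square_path_keep:
  assumes "opt_median (us @ xs)"
  shows "square_path (keep xs)"
  using assms
proof (induction xs arbitrary: us rule: keep.induct)
  case (1 a b c xs)
  have m: "median (us @ a # b # c # xs)" using 1(3) by (simp add: opt_median_def)
  have ab: "A a b" using median_consec m by blast
  show ?case
  proof (cases "A c a")
    case True
    have sp: "square_path (keep xs)" using 1(1)[OF True, of "us @ [a, b, c]"] 1(3) by simp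
    have "square_path (b # keep xs)"
    proof (cases xs)
      case Nil
      then show ?thesis by simp
    next
      case (Cons d ys)
      have bd: "A b d" using median_after_triangle(2)[of us a b c d ys] m True Cons by simp
      show ?thesis
      proof (cases ys)
        case Nil
        then show ?thesis using Cons bd by simp
      next
        case (Cons e zs)
        have "A b e" using opt_median_skip[of us a b c d e zs] 1(3) True \<open>xs = d # ys\<close> Cons by simp
        then show ?thesis using sp bd keep_Cons2[of d e zs] \<open>xs = d # ys\<close> Cons by (auto intro: square_path_ConsI)
      qed
    qed
    moreover have "A a d" if "keep xs = d # zs" for d zs
    proof -
      have "\<exists>ys. xs = d # ys" using that by (cases xs rule: keep.cases) (auto split: if_splits)
      then show ?thesis using median_after_triangle(1)[of us a b c d] m True by auto
    qed
    ultimately show ?thesis using True ab by (auto intro: square_path_ConsI)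
  next
    case False
    have "a \<noteq> c \<and> a \<in> V \<and> c \<in> V" using median_in[of us "[a, b, c]" xs] m by auto
    then have "A a c" using False total_A by blast
    moreover have "square_path (keep (b # c # xs))" using 1(2)[OF False, of "us @ [a]"] 1(3) by simp
    ultimately show ?thesis using False ab keep_Cons2[of b c xs] by (auto intro: square_path_ConsI)
  qed
next
  case ("2_2" a)
  then show ?case by simp
next
  case ("2_3" a b)
  then show ?case using median_consec[of us a b "[]"] by (simp add: opt_median_def)
qed simp

lemma square_path_nth:
  assumes "square_path xs"
  shows "i + 1 < length xs \<Longrightarrow> A (xs ! i) (xs ! (i + 1))" "i + 2 < length xs \<Longrightarrow> A (xs ! i) (xs ! (i + 2))"
  using assms by (induction xs arbitrary: i rule: square_path.induct; case_tac i; simp)+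

lemma ex_walk2:
  assumes "3 * k \<le> 2 * card V + 2"
  shows "\<exists>f. walk 2 k f"
proof -
  obtain xs where xs: "opt_median xs" using opt_median_exists by blast
  then have o: "distinct xs" "set xs = V" by (auto simp: opt_median_def median_def order_of_def)
  have sp: "square_path (keep xs)" using square_path_keep[of "[]" xs] xs by simp
  \<comment> \<open>The slack \<open>2\<close> in the hypothesis rounds two thirds of
    \<open>card V\<close> up.\<close>
  have "k \<le> length (keep xs)" using length_keep[of xs] o distinct_card[OF o(1)] assms by simp
  then have "walk 2 k (\<lambda>i. keep xs ! i)" unfolding walk_def
    using square_path_nth[OF sp] set_keep[of xs] o(2) by (auto simp: subset_iff)
  then show ?thesis by blast
qed

lemma ex_hamiltonian_path:
  "\<exists>xs. distinct xs \<and> set xs = V \<and> (\<forall>i. i + 1 < length xs \<longrightarrow> A (xs ! i) (xs ! (i + 1)))"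
proof -
  obtain xs where "opt_median xs" using opt_median_exists by blast
  then have xs: "median xs" by (simp add: opt_median_def)
  have "A (xs ! i) (xs ! (i + 1))" if "i + 1 < length xs" for i
  proof -
    have "xs = take i xs @ xs ! i # xs ! (i + 1) # drop (i + 2) xs"
      using that by (simp add: Cons_nth_drop_Suc)
    then show ?thesis using median_consec[of "take i xs" "xs ! i" "xs ! (i + 1)"] xs by metis
  qed
  then show ?thesis using xs by (auto simp: median_def order_of_def)
qed


section \<open>Upper bounds\<close>

lemma ex_walk3:
  assumes "3 * k \<le> card V"
  shows "\<exists>f. walk 3 k f"
proof -
  \<comment> \<open>Generalized to subtournaments \<open>W\<close>, because each induction step
    deletes a cover; at most three vertices per step account for \<open>3 * k\<close>.\<close>
  have "\<exists>f. walk 3 k f \<and> (\<forall>i<k. f i \<in> W)" if "\<not> infwalk" "W \<subseteq> V" "3 * k \<le> card W" for W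
    using that(2,3)
  proof (induction k arbitrary: W)
    case 0
    then show ?case by (auto simp: walk_def)
  next
    case (Suc k)
    interpret W: tour W A
    proof
      show "finite W" using finite_V Suc.prems(1) by (rule rev_finite_subset)
      show "\<And>u v. A u v \<Longrightarrow> \<not> A v u" by (rule asym_A)
      show "\<And>u v. u \<in> W \<Longrightarrow> v \<in> W \<Longrightarrow> u \<noteq> v \<Longrightarrow> A u v \<or> A v u" using total_A Suc.prems(1) by blast
    qed
    show ?case
    proof (cases "k < 3")
      case True
      \<comment> \<open>On at most three vertices there are no arcs at distance three, so a
        Hamiltonian path suffices.\<close>
      obtain xs where xs: "distinct xs" "set xs = W" "\<forall>i. i + 1 < length xs \<longrightarrow> A (xs ! i) (xs ! (i + 1))"
        using W.ex_hamiltonian_path by blast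
      have "Suc k \<le> length xs" using Suc.prems(2) distinct_card[OF xs(1)] xs(2) by simp
      then have "walk 3 (Suc k) ((!) xs) \<and> (\<forall>i<Suc k. xs ! i \<in> W)"
        using xs True Suc.prems(1) nth_mem[of _ xs] unfolding walk_def by auto
      then show ?thesis by blast
    next
      case False
      have "walk 3 m f" if "W.walk 3 m f" for m f
        using that Suc.prems(1) unfolding walk_def W.walk_def by auto
      then have "\<not> W.infwalk" using that(1) unfolding infwalk_def W.infwalk_def by blast
      then obtain R where R: "R \<subseteq> W" "card R \<le> 3" "\<And>a c. W.dpair a c \<Longrightarrow> a \<in> R \<or> c \<in> R"
        using W.dpair_cover by blast
      have "card (W - R) \<ge> 3 * k"
        using Suc.prems(2) R(1,2) W.finite_V by (simp add: card_Diff_subset finite_subset)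
      then obtain f where f: "walk 3 k f" "\<forall>i<k. f i \<in> W - R" using Suc.IH[of "W - R"] Suc.prems(1) by blast
      obtain j where k: "k = j + 3" using False by (metis add.commute le_Suc_ex not_less)
      \<comment> \<open>The new vertex must be dominated by the last vertex and the third from the
        end. These differ and avoid \<open>R\<close>, so they have a common out-neighbour in
        \<open>W\<close>, possibly one already visited.\<close>
      have "A (f j) (f (j + 1))" "A (f (j + 1)) (f (j + 2))"
        using f(1) k unfolding walk_def by (auto dest: spec[of _ j] spec[of _ "j + 1"])
      then have "f j \<noteq> f (j + 2)" using asym_A by metis
      moreover have "f j \<in> W - R" "f (j + 2) \<in> W - R" using f(2) k by auto
      ultimately obtain d where d: "d \<in> W" "A (f j) d" "A (f (j + 2)) d"
        using R(3)[of "f j" "f (j + 2)"] unfolding W.dpair_def by blast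
      have "walk 3 (Suc k) (f(k := d)) \<and> (\<forall>i<Suc k. (f(k := d)) i \<in> W)"
      proof -
        have "A (f i) d" if "Suc i = k \<or> i + 3 = k" for i
          using that d k by (auto simp: numeral_eq_Suc)
        then show ?thesis using f d(1) Suc.prems(1) by (auto simp: walk_def less_Suc_eq)
      qed
      then show ?thesis by blast
    qed
  qed
  then show ?thesis using assms unfolding infwalk_def by blast
qed

section \<open>Closed walks and the case of \<open>l\<close> at least four\<close>

definition closed_walk :: "'a list \<Rightarrow> bool" where
  "closed_walk xs \<longleftrightarrow> set xs \<subseteq> V \<and> xs \<noteq> [] \<and> successively A (xs @ [hd xs])"

lemma closed_walk_append:
  assumes "closed_walk (x # us)" "closed_walk (x # vs)"
  shows "closed_walk (x # us @ x # vs)"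
  using assms successively_cyclic_append[of A x us vs] by (auto simp: closed_walk_def)

text \<open>Inserting the closed walk of length three at \<open>x\<close> reduces every length to
  three, four or five.\<close>

lemma closed_walks_all_lengths:
  assumes "closed_walk (x # us)" "length us = 2" "closed_walk (x # vs)" "length vs = 3"
    "closed_walk (x # ws)" "length ws = 4" "3 \<le> r"
  shows "\<exists>zs. closed_walk (x # zs) \<and> Suc (length zs) = r"
  using assms(7)
proof (induction r rule: less_induct)
  case (less r)
  show ?case
  proof (cases "r < 6")
    case True
    then have "r = 3 \<or> r = 4 \<or> r = 5" using less.prems by auto
    then show ?thesis using assms by auto
  next
    case False
    then have "r - 3 < r" "3 \<le> r - 3" by auto
    then obtain zs where "closed_walk (x # zs)" "Suc (length zs) = r - 3" using less.IH[of "r - 3"] by blast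
    then show ?thesis using closed_walk_append[OF assms(1)] assms(2) False
      by (intro exI[of _ "us @ x # zs"]) auto
  qed
qed

lemma closed_walk_walk:
  assumes "closed_walk xs" "length xs + 1 = l"
  shows "\<exists>f. walk l k f"
proof -
  let ?m = "length xs"
  let ?f = "\<lambda>i. xs ! (i mod ?m)"
  have m: "?m > 0" using assms(1) by (auto simp: closed_walk_def)
  have step: "A (?f i) (?f (i + 1))" for i
  proof -
    let ?j = "i mod ?m"
    have j: "?j < ?m" using m by simp
    have "A ((xs @ [hd xs]) ! ?j) ((xs @ [hd xs]) ! Suc ?j)"
      using assms(1) j successively_nth[of A "xs @ [hd xs]" ?j] by (simp add: closed_walk_def)
    moreover have "(xs @ [hd xs]) ! Suc ?j = xs ! (Suc ?j mod ?m)"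
    proof (cases "Suc ?j = ?m")
      case True
      then show ?thesis using m by (simp add: nth_append hd_conv_nth)
    next
      case False
      then show ?thesis using j by (simp add: nth_append)
    qed
    ultimately show ?thesis using j by (simp add: nth_append mod_Suc_eq)
  qed
  have "A (?f i) (?f (i + l))" for i
  proof -
    have "i + l = (i + 1) + ?m" using assms(2) by simp
    then have "?f (i + l) = ?f (i + 1)" by (simp only: mod_add_self2)
    then show ?thesis using step by simp
  qed
  moreover have "?f i \<in> V" for i using assms(1) m nth_mem[of "i mod ?m" xs] by (auto simp: closed_walk_def)
  ultimately have "walk l k ?f" using step unfolding walk_def by blast
  then show ?thesis by blast
qed

lemma ex_walk_ge4:
  assumes "4 \<le> l" "k \<le> card V"
  shows "\<exists>f. walk l k f"
proof -
  obtain xs where xs: "distinct xs" "set xs = V" "\<And>i. i + 1 < length xs \<Longrightarrow> A (xs ! i) (xs ! (i + 1))"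
    using ex_hamiltonian_path by blast
  have len: "length xs = card V" using distinct_card[OF xs(1)] xs(2) by simp
  show ?thesis
  proof (cases "\<forall>i. i + l < length xs \<longrightarrow> A (xs ! i) (xs ! (i + l))")
    case True
    then have "walk l k ((!) xs)" using xs nth_mem[of _ xs] len assms(2) unfolding walk_def by auto
    then show ?thesis by blast
  next
    case False
    then obtain i where i: "i + l < length xs" "\<not> A (xs ! i) (xs ! (i + l))" by blast
    define c where "c t = xs ! (i + t)" for t
    have cV: "c t \<in> V" if "t \<le> l" for t using that i(1) xs(2) nth_mem[of "i + t" xs] by (simp add: c_def)
    have step: "A (c t) (c (Suc t))" if "t < l" for t using xs(3)[of "i + t"] i(1) that by (simp add: c_def)
    have tot: "A (c s) (c t) \<or> A (c t) (c s)" if "s < t" "t \<le> l" for s t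
      using that cV[of s] cV[of t] total_A[of "c s" "c t"] i(1) nth_eq_iff_index_eq[OF xs(1)]
      by (auto simp: c_def)
    have wrap: "A (c l) (c 0)" using tot[of 0 l] i(2) assms(1) by (auto simp: c_def)
    have succs: "successively A (map c [s..<t])" if "t \<le> Suc l" for s t
      unfolding successively_conv_nth using that step by auto
    \<comment> \<open>The cycle \<open>c 0\<close>, ..., \<open>c l\<close> has two vertices too
      many; a forward chord spanning three steps skips exactly two.\<close>
    have "\<exists>ys. closed_walk ys \<and> length ys + 1 = l"
    proof (cases "\<exists>t. t + 3 \<le> l \<and> A (c t) (c (t + 3))")
      case True
      then obtain t where t: "t + 3 \<le> l" "A (c t) (c (t + 3))" by blast
      let ?ys = "map c [0..<Suc t] @ map c [t + 3..<Suc l]"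
      have "successively A (?ys @ [c 0])"
        using t succs[of "Suc t" 0] succs[of "Suc l" "t + 3"] wrap
        by (simp add: successively_append_iff hd_map last_map del: upt_Suc)
      moreover have "hd ?ys = c 0" by (simp add: hd_append hd_map del: upt_Suc)
      moreover have "set ?ys \<subseteq> V" using cV t by auto
      ultimately have "closed_walk ?ys" unfolding closed_walk_def by auto
      moreover have "length ?ys + 1 = l" using t by simp
      ultimately show ?thesis by blast
    next
      case False
      \<comment> \<open>With all such chords pointing backwards, \<open>c 0\<close>, ...,
        \<open>c 4\<close> carry closed walks through \<open>c 0\<close> of lengths three, four and
        five, whichever way the arcs from \<open>c 0\<close> to \<open>c 2\<close> and
        \<open>c 4\<close> point.\<close>
      have b: "A (c (t + 3)) (c t)" if "t + 3 \<le> l" for t using False that tot[of t "t + 3"] by auto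
      have 1: "A (c 0) (c 1)" "A (c 1) (c 2)" "A (c 2) (c 3)" "A (c 3) (c 4)" "A (c 3) (c 0)" "A (c 4) (c 1)"
        using step[of 0] step[of 1] step[of 2] step[of 3] b[of 0] b[of 1] assms(1) by (simp_all add: numeral_eq_Suc)
      have V: "c 0 \<in> V" "c 1 \<in> V" "c 2 \<in> V" "c 3 \<in> V" "c 4 \<in> V" using cV assms(1) by auto
      have 4: "closed_walk [c 0, c 1, c 2, c 3]" using 1 V by (simp add: closed_walk_def)
      have 3: "closed_walk [c 0, c 1, c 2] \<or> closed_walk [c 0, c 2, c 3]"
        using 1 V tot[of 0 2] assms(1) by (auto simp: closed_walk_def)
      have 5: "closed_walk [c 0, c 1, c 2, c 3, c 4] \<or> closed_walk [c 0, c 4, c 1, c 2, c 3]"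
        using 1 V tot[of 0 4] assms(1) by (auto simp: closed_walk_def)
      obtain us where us: "closed_walk (c 0 # us)" "length us = 2" using 3 by fastforce
      obtain ws where ws: "closed_walk (c 0 # ws)" "length ws = 4" using 5 by fastforce
      show ?thesis using closed_walks_all_lengths[OF us 4 _ ws, of "l - 1"] assms(1) by force
    qed
    then show ?thesis using closed_walk_walk by blast
  qed
qed

end


section \<open>Homomorphisms and lower bounds\<close>

lemma compressibility_le: "maps_to_all_tournaments H n \<Longrightarrow> compressibility H \<le> enat n"
  unfolding compressibility_def by (rule Inf_lower) blast

lemma compressibility_ge:
  assumes "\<And>m. maps_to_all_tournaments H m \<Longrightarrow> n \<le> m"
  shows "enat n \<le> compressibility H"
  unfolding compressibility_def by (rule Inf_greatest) (use assms in auto)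

abbreviation arc_rel :: "'b pair_pre_digraph \<Rightarrow> 'b \<Rightarrow> 'b \<Rightarrow> bool" where
  "arc_rel T u v \<equiv> (u, v) \<in> parcs T"

lemma tour_tournament:
  assumes "tournament T"
  shows "tour (pverts T) (arc_rel T)"
proof -
  interpret tournament T by (fact assms)
  show ?thesis
  proof
    show "finite (pverts T)" by (rule pair_finite_verts)
    show "\<And>u v. arc_rel T u v \<Longrightarrow> \<not> arc_rel T v u" using asym_arcs by (auto dest: asymD)
    show "\<And>u v. u \<in> pverts T \<Longrightarrow> v \<in> pverts T \<Longrightarrow> u \<noteq> v \<Longrightarrow> arc_rel T u v \<or> arc_rel T v u"
      using total_arcs by (auto simp: total_on_def)
  qed
qed

text \<open>Path vertices are numbered from 1 and walk positions from 0, hence the shifts.\<close>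

lemma digraph_hom_dpath_iff:
  assumes "tournament T"
  shows "(\<exists>f. digraph_hom f (dpath l k) T) \<longleftrightarrow> (\<exists>f. tour.walk (pverts T) (arc_rel T) l k f)"
proof -
  interpret tour "pverts T" "arc_rel T" using assms by (rule tour_tournament)
  have "walk l k (\<lambda>i. f (i + 1))" if h: "digraph_hom f (dpath l k) T" for f
  proof -
    have "(i + 1, i + 1 + 1) \<in> parcs (dpath l k)" if "i + 1 < k" for i
      using that by (auto simp: dpath_def)
    moreover have "(i + 1, i + l + 1) \<in> parcs (dpath l k)" if "i + l < k" for i
      using that by (auto simp: dpath_def)
    moreover have "i + 1 \<in> pverts (dpath l k)" if "i < k" for i
      using that by (simp add: dpath_def)
    ultimately show ?thesis using h unfolding digraph_hom_def walk_def by blast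
  qed
  moreover have "digraph_hom (\<lambda>i. f (i - 1)) (dpath l k) T" if w: "walk l k f" for f
    unfolding digraph_hom_def
  proof (intro conjI ballI allI impI)
    fix v assume "v \<in> pverts (dpath l k)"
    then have "v - 1 < k" by (auto simp: dpath_def)
    then show "f (v - 1) \<in> pverts T" using w by (simp add: walk_def)
  next
    fix u v assume "(u, v) \<in> parcs (dpath l k)"
    then have "v - 1 = (u - 1) + 1 \<and> (u - 1) + 1 < k \<or> v - 1 = (u - 1) + l \<and> (u - 1) + l < k"
      by (auto simp: dpath_def)
    then show "arc_rel T (f (u - 1)) (f (v - 1))" using w unfolding walk_def by metis
  qed
  ultimately show ?thesis by blast
qed

lemma maps_dpathI:
  assumes "\<And>(V :: nat set) A. tour V A \<Longrightarrow> card V = n \<Longrightarrow> \<exists>f. tour.walk V A l k f"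
  shows "maps_to_all_tournaments (dpath l k) n"
  unfolding maps_to_all_tournaments_def
proof (intro allI impI)
  fix T :: "nat pair_pre_digraph"
  assume T: "tournament T" "card (pverts T) = n"
  show "\<exists>f. digraph_hom f (dpath l k) T"
    unfolding digraph_hom_dpath_iff[OF T(1)] using assms[OF tour_tournament[OF T(1)] T(2)] .
qed

text \<open>The remainder is made transitive, since an incomplete copy of \<open>B\<close> may admit walks longer than its
  number of vertices.\<close>

definition block_arc :: "nat \<Rightarrow> (nat \<Rightarrow> nat \<Rightarrow> bool) \<Rightarrow> nat \<Rightarrow> nat \<Rightarrow> nat \<Rightarrow> bool" where
  "block_arc s B m u v \<longleftrightarrow> u div s < v div s \<or> u div s = v div s \<and>
     (if u div s < m div s then B (u mod s) (v mod s) else u < v)"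

text \<open>By \<open>short\<close>, \<open>B\<close> admits no walk on \<open>c + 1\<close>
  vertices. Block numbers never decrease along a walk, so each full block holds at most
  \<open>c\<close> positions, and the transitive remainder at most \<open>m mod s\<close>.\<close>

lemma maps_dpath_block_bound:
  assumes "0 < s"
    and asym: "\<And>u v. B u v \<Longrightarrow> \<not> B v u"
    and total: "\<And>u v. u < s \<Longrightarrow> v < s \<Longrightarrow> u \<noteq> v \<Longrightarrow> B u v \<or> B v u"
    and short: "\<And>g. (\<And>t. t \<le> c \<Longrightarrow> g t < s) \<Longrightarrow> (\<And>t. t < c \<Longrightarrow> B (g t) (g (t + 1))) \<Longrightarrow>
      (\<And>t. t + l \<le> c \<Longrightarrow> B (g t) (g (t + l))) \<Longrightarrow> False"
    and maps: "maps_to_all_tournaments (dpath l k) m"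
  shows "k \<le> c * (m div s) + m mod s"
proof (cases "k = 0")
  case False
  define T where "T = \<lparr> pverts = {..<m}, parcs = {(u, v). u < m \<and> v < m \<and> block_arc s B m u v} \<rparr>"
  have nb: False if uv: "block_arc s B m u v" "block_arc s B m v u" for u v
  proof -
    have e: "u div s = v div s" using uv unfolding block_arc_def by linarith
    show False
    proof (cases "v div s < m div s")
      case True
      then have "B (u mod s) (v mod s)" "B (v mod s) (u mod s)" using uv unfolding block_arc_def e by simp_all
      then show False using asym by blast
    next
      case False
      then have "u < v \<and> v < u" using uv unfolding block_arc_def e by simp
      then show False by linarith
    qed
  qed
  have "tournament T"
  proof
    show "finite (pverts T)" by (simp add: T_def)
    show "finite (parcs T)" by (rule finite_subset[of _ "{..<m} \<times> {..<m}"]) (auto simp: T_def)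
    show "fst e \<in> pverts T" "snd e \<in> pverts T" if "e \<in> parcs T" for e
      using that by (auto simp: T_def)
    show "fst e \<noteq> snd e" if "e \<in> parcs T" for e
      using that nb[of "fst e" "fst e"] by (auto simp: T_def)
    show "asym (parcs T)" unfolding T_def by (rule asymI) (simp, blast dest: nb)
    show "total_on (pverts T) (parcs T)"
    proof (rule total_onI)
      fix u v assume uv: "u \<in> pverts T" "v \<in> pverts T" "u \<noteq> v"
      have "u div s = v div s \<Longrightarrow> u mod s \<noteq> v mod s" using uv(3) by (metis div_mult_mod_eq)
      then have "block_arc s B m u v \<or> block_arc s B m v u"
        using total[of "u mod s" "v mod s"] assms(1) uv(3) unfolding block_arc_def
        by (metis mod_less_divisor nat_neq_iff)
      then show "arc_rel T u v \<or> arc_rel T v u" using uv by (auto simp: T_def)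
    qed
  qed
  moreover have "card (pverts T) = m" by (simp add: T_def)
  ultimately have "\<exists>f. digraph_hom f (dpath l k) T" using maps unfolding maps_to_all_tournaments_def by blast
  then obtain f where f: "tour.walk (pverts T) (arc_rel T) l k f"
    unfolding digraph_hom_dpath_iff[OF \<open>tournament T\<close>] by blast
  interpret tour "pverts T" "arc_rel T" using \<open>tournament T\<close> by (rule tour_tournament)
  note f = f[unfolded walk_def]
  have fm: "f i < m" if "i < k" for i using f that by (simp add: T_def)
  have f1: "block_arc s B m (f i) (f (i + 1))" if "i + 1 < k" for i using f that by (simp add: T_def)
  have fl: "block_arc s B m (f i) (f (i + l))" if "i + l < k" for i using f that by (simp add: T_def)
  define b where "b i = f i div s" for i
  have mono: "b i \<le> b (i + d)" if "i + d < k" for i d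
    using that
  proof (induction d)
    case (Suc d)
    then have "b i \<le> b (i + d)" "b (i + d) \<le> b (i + d + 1)"
      using f1[of "i + d"] unfolding b_def block_arc_def by auto
    then show ?case by simp
  qed simp
  have bq: "b i \<le> m div s" if "i < k" for i using fm[OF that] by (simp add: b_def div_le_mono)
  have blocks: "j \<le> b i" if "i < k" "c * j \<le> i" "j \<le> m div s" for i j
    using that
  proof (induction j arbitrary: i)
    case (Suc j)
    then have "c + c * j \<le> i" by simp
    then obtain i0 where i0: "i = i0 + c" "c * j \<le> i0" using le_Suc_ex[of "c + c * j" i] by auto
    have j: "j \<le> b i0" using Suc i0 by simp
    show ?case
    proof (rule ccontr)
      assume "\<not> Suc j \<le> b i"
      \<comment> \<open>By monotonicity all \<open>c + 1\<close> positions from \<open>i0\<close> to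
        \<open>i\<close> lie in the full block \<open>j\<close>, against
        \<open>short\<close>.\<close>
      then have bj: "b (i0 + t) = j" if "t \<le> c" for t
        using j mono[of i0 t] mono[of "i0 + t" "c - t"] that Suc.prems(1) i0(1) by simp
      define g where "g t = f (i0 + t) mod s" for t
      have arcB: "B (g t) (g t')" if "t \<le> c" "t' \<le> c" "block_arc s B m (f (i0 + t)) (f (i0 + t'))" for t t'
        using that bj[of t] bj[of t'] Suc.prems(3) unfolding block_arc_def b_def g_def by (simp split: if_splits)
      show False
      proof (rule short[of g])
        show "g t < s" for t using assms(1) by (simp add: g_def)
        show "B (g t) (g (t + 1))" if "t < c" for t
          using arcB[of t "t + 1"] f1[of "i0 + t"] that Suc.prems(1) i0(1) by (simp add: add.assoc)
        show "B (g t) (g (t + l))" if "t + l \<le> c" for t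
          using arcB[of t "t + l"] fl[of "i0 + t"] that Suc.prems(1) i0(1) by (simp add: add.assoc)
      qed
    qed
  qed simp
  let ?q = "m div s"
  \<comment> \<open>Inside the remainder the vertex numbers strictly increase, and they must stay
    below \<open>m\<close>.\<close>
  have rest: "?q * s + d \<le> f (c * ?q + d)" if "c * ?q + d < k" for d
    using that
  proof (induction d)
    case 0
    then have "?q \<le> f (c * ?q) div s" using blocks[of "c * ?q" ?q] by (simp add: b_def)
    then show ?case using assms(1) by (simp add: less_eq_div_iff_mult_less_eq)
  next
    case (Suc d)
    let ?i = "c * ?q + d"
    have "b ?i = ?q" "b (?i + 1) = ?q" using blocks[of ?i ?q] blocks[of "?i + 1" ?q] bq Suc.prems
      by (auto intro: antisym)
    then have "f ?i < f (?i + 1)" using f1[of ?i] Suc.prems by (simp add: block_arc_def b_def)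
    then show ?case using Suc by simp
  qed
  show ?thesis
  proof (rule ccontr)
    assume "\<not> ?thesis"
    then have "c * ?q + m mod s < k" by simp
    from rest[OF this] fm[OF this] show False by (metis div_mult_mod_eq not_less)
  qed
qed simp

section \<open>The blocks for \<open>l = 2\<close> and \<open>l = 3\<close>\<close>

definition block3 :: "nat \<Rightarrow> nat \<Rightarrow> bool" where
  "block3 u v \<longleftrightarrow> u = 0 \<and> v = 1 \<or> u = 1 \<and> v = 2 \<or> u = 2 \<and> v = 0"

lemma block3_short: "block3 a b \<Longrightarrow> block3 b c \<Longrightarrow> block3 a c \<Longrightarrow> False"
  unfolding block3_def by presburger

definition block7 :: "nat \<Rightarrow> nat \<Rightarrow> bool" where
  "block7 u v \<longleftrightarrow> (if u = 6 then v = 0 \<or> v = 1 \<or> v = 3 else if v = 6 then u = 2 \<or> u = 4 \<or> u = 5 else u < v)"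

text \<open>A visit to \<open>6\<close> at an inner position would make the walk climb from an
  in-neighbour of \<open>6\<close>, at least \<open>2\<close>, to an out-neighbour, at most
  \<open>3\<close>, in two or more increasing steps. So \<open>6\<close> can occur only at the two
  ends.\<close>

lemma block7_short:
  assumes lt: "a0 < 7" "a1 < 7" "a2 < 7" "a3 < 7" "a4 < 7" "a5 < 7" "a6 < 7"
    and b: "block7 a0 a1" "block7 a1 a2" "block7 a2 a3" "block7 a3 a4" "block7 a4 a5" "block7 a5 a6"
      "block7 a0 a3" "block7 a1 a4" "block7 a2 a5" "block7 a3 a6"
  shows False
proof -
  have up: "u < v" if "block7 u v" "u \<noteq> 6" "v \<noteq> 6" for u v using that by (simp add: block7_def)
  have into: "u = 2 \<or> u = 4 \<or> u = 5" if "block7 u 6" for u using that by (auto simp: block7_def split: if_splits)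
  have out: "v = 0 \<or> v = 1 \<or> v = 3" if "block7 6 v" for v using that by (simp add: block7_def)
  have 3: "a3 \<noteq> 6"
  proof
    assume e: "a3 = 6"
    have i: "a2 = 2 \<or> a2 = 4 \<or> a2 = 5" "a0 = 2 \<or> a0 = 4 \<or> a0 = 5" using into[of a2] into[of a0] b(3,7) e by auto
    have o: "a4 = 0 \<or> a4 = 1 \<or> a4 = 3" "a6 = 0 \<or> a6 = 1 \<or> a6 = 3" using out[of a4] out[of a6] b(4,10) e by auto
    have "a1 \<noteq> 6" using out[of a2] b(2) i(1) by auto
    moreover have "a5 \<noteq> 6" using into[of a4] b(5) o(1) by auto
    ultimately have "a0 < a1" "a1 < a4" "a4 < a5" "a5 < a6" using up[OF b(1)] up[OF b(8)] up[OF b(5)] up[OF b(6)] i o by auto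
    then show False using i o by linarith
  qed
  have 2: "a2 \<noteq> 6"
  proof
    assume e: "a2 = 6"
    have i: "a1 = 2 \<or> a1 = 4 \<or> a1 = 5" using into[of a1] b(2) e by auto
    have o: "a3 = 0 \<or> a3 = 1 \<or> a3 = 3" "a5 = 0 \<or> a5 = 1 \<or> a5 = 3" using out[of a3] out[of a5] b(3,9) e by auto
    have "a4 \<noteq> 6" using into[of a3] b(4) o(1) by auto
    then have "a1 < a4" "a4 < a5" using up[OF b(8)] up[OF b(5)] i o by auto
    then show False using i o by linarith
  qed
  have 4: "a4 \<noteq> 6"
  proof
    assume e: "a4 = 6"
    have i: "a3 = 2 \<or> a3 = 4 \<or> a3 = 5" "a1 = 2 \<or> a1 = 4 \<or> a1 = 5" using into[of a3] into[of a1] b(4,8) e by auto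
    have o: "a5 = 0 \<or> a5 = 1 \<or> a5 = 3" using out[of a5] b(5) e by auto
    have "a1 < a2" "a2 < a5" using up[OF b(2)] up[OF b(9)] i o 2 by auto
    then show False using i o by linarith
  qed
  have 1: "a1 \<noteq> 6"
  proof
    assume e: "a1 = 6"
    have i: "a0 = 2 \<or> a0 = 4 \<or> a0 = 5" using into[of a0] b(1) e by auto
    have o: "a4 = 0 \<or> a4 = 1 \<or> a4 = 3" using out[of a4] b(8) e by auto
    have "a0 < a3" "a3 < a4" using up[OF b(7)] up[OF b(4)] i o 3 by auto
    then show False using i o by linarith
  qed
  have 5: "a5 \<noteq> 6"
  proof
    assume e: "a5 = 6"
    have i: "a2 = 2 \<or> a2 = 4 \<or> a2 = 5" using into[of a2] b(9) e by auto
    have o: "a6 = 0 \<or> a6 = 1 \<or> a6 = 3" using out[of a6] b(6) e by auto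
    have "a2 < a3" "a3 < a6" using up[OF b(3)] up[OF b(10)] i o 3 by auto
    then show False using i o by linarith
  qed
  \<comment> \<open>Both \<open>a0 = 6\<close> and \<open>a0 < a1\<close> force
    \<open>a3 = 3\<close>. As \<open>3\<close> does not dominate \<open>6\<close>, the vertex
    \<open>a6\<close> would have to lie below \<open>6\<close> and yet exceed \<open>a3\<close> by
    at least three.\<close>
  have "a1 < a2" "a2 < a3" "a3 < a4" "a4 < a5" using up[OF b(2)] up[OF b(3)] up[OF b(4)] up[OF b(5)] 1 2 3 4 5 by auto
  moreover have "a0 < a1 \<or> a3 = 0 \<or> a3 = 1 \<or> a3 = 3" using up[OF b(1)] out[of a3] b(7) 1 by auto
  moreover have "a5 < a6 \<and> a6 < 6 \<or> a3 = 2 \<or> a3 = 4 \<or> a3 = 5"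
  proof (cases "a6 = 6")
    case True
    then show ?thesis using into[of a3] b(10) by simp
  next
    case False
    then show ?thesis using up[OF b(6) 5] lt(7) by simp
  qed
  moreover have "a5 < 6" using 5 lt(6) by simp
  ultimately show False by linarith
qed

theorem theorem15:
  "(\<forall>k :: nat. 2 < k \<longrightarrow> compressibility (dpath 2 k) = enat ((3 * k - 1) div 2)) \<and>
   (\<forall>k :: nat. 3 < k \<longrightarrow>
      enat ((7 * k - 1) div 6) \<le> compressibility (dpath 3 k) \<and>
      compressibility (dpath 3 k) \<le> enat (3 * k)) \<and>
   (\<forall>k l :: nat. 4 \<le> l \<longrightarrow> l < k \<longrightarrow> compressibility (dpath l k) = enat k)"
proof (intro conjI allI impI)
  fix k :: nat
  have "maps_to_all_tournaments (dpath 2 k) ((3 * k - 1) div 2)"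
    by (rule maps_dpathI) (rule tour.ex_walk2, assumption, simp)
  moreover have "(3 * k - 1) div 2 \<le> m" if "maps_to_all_tournaments (dpath 2 k) m" for m
  proof -
    have "k \<le> 2 * (m div 3) + m mod 3"
    proof (rule maps_dpath_block_bound[where B = block3, OF _ _ _ _ that])
      show "block3 u v \<Longrightarrow> \<not> block3 v u" for u v
        unfolding block3_def by presburger
      show "u < 3 \<Longrightarrow> v < 3 \<Longrightarrow> u \<noteq> v \<Longrightarrow> block3 u v \<or> block3 v u" for u v
        unfolding block3_def by presburger
      show False if "\<And>t. t < 2 \<Longrightarrow> block3 (g t) (g (t + 1))" "\<And>t. t + 2 \<le> 2 \<Longrightarrow> block3 (g t) (g (t + 2))"
        for g :: "nat \<Rightarrow> nat"
        using block3_short[of "g 0" "g 1" "g 2"] that(1)[of 0] that(1)[of 1] that(2)[of 0]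
        by (simp add: numeral_2_eq_2)
    qed simp
    moreover have "m = 3 * (m div 3) + m mod 3" "m mod 3 < 3" by simp_all
    \<comment> \<open>Indeed \<open>3 * k\<close> is at most \<open>2 * m + m mod 3\<close>.\<close>
    ultimately have "3 * k \<le> 2 * m + 2" by linarith
    then show ?thesis by presburger
  qed
  ultimately show "compressibility (dpath 2 k) = enat ((3 * k - 1) div 2)"
    using compressibility_le compressibility_ge antisym by metis
next
  fix k :: nat
  have "(7 * k - 1) div 6 \<le> m" if "maps_to_all_tournaments (dpath 3 k) m" for m
  proof -
    have "k \<le> 6 * (m div 7) + m mod 7"
    proof (rule maps_dpath_block_bound[where B = block7, OF _ _ _ _ that])
      show "block7 u v \<Longrightarrow> \<not> block7 v u" for u v by (auto simp: block7_def split: if_splits)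
      show "u < 7 \<Longrightarrow> v < 7 \<Longrightarrow> u \<noteq> v \<Longrightarrow> block7 u v \<or> block7 v u" for u v
        by (auto simp: block7_def)
      show False if lt: "\<And>t. t \<le> 6 \<Longrightarrow> g t < 7" and "\<And>t. t < 6 \<Longrightarrow> block7 (g t) (g (t + 1))"
        "\<And>t. t + 3 \<le> 6 \<Longrightarrow> block7 (g t) (g (t + 3))" for g :: "nat \<Rightarrow> nat"
        by (rule block7_short[of "g 0" "g 1" "g 2" "g 3" "g 4" "g 5" "g 6"])
          (use lt that(2)[of 0] that(2)[of 1] that(2)[of 2] that(2)[of 3] that(2)[of 4] that(2)[of 5]
            that(3)[of 0] that(3)[of 1] that(3)[of 2] that(3)[of 3] in \<open>simp_all add: numeral_eq_Suc\<close>)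
    qed simp
    moreover have "m = 7 * (m div 7) + m mod 7" "m mod 7 < 7" by simp_all
    ultimately have "7 * k \<le> 6 * m + 6" by linarith
    then show ?thesis by presburger
  qed
  then show "enat ((7 * k - 1) div 6) \<le> compressibility (dpath 3 k)" by (rule compressibility_ge)
  have "maps_to_all_tournaments (dpath 3 k) (3 * k)"
    by (rule maps_dpathI) (rule tour.ex_walk3, assumption, simp)
  then show "compressibility (dpath 3 k) \<le> enat (3 * k)" by (rule compressibility_le)
next
  fix k l :: nat
  assume l: "4 \<le> l"
  have "maps_to_all_tournaments (dpath l k) k"
    by (rule maps_dpathI) (rule tour.ex_walk_ge4, assumption, rule l, simp)
  moreover have "k \<le> m" if "maps_to_all_tournaments (dpath l k) m" for m
    \<comment> \<open>One-vertex blocks with the empty relation make the transitive tournament on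
      \<open>m\<close> vertices.\<close>
    using maps_dpath_block_bound[of 1 "\<lambda>_ _. False" 1 l k m, OF _ _ _ _ that] by simp
  ultimately show "compressibility (dpath l k) = enat k"
    using compressibility_le compressibility_ge antisym by metis
qed

end
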